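(* Suppose that: (B) there is a constant $B<\infty$ such that $\Pr(|X_{n+1}-X_n|\le B)=1$ for all $n\in\mathbb{Z}_+$; (N) $\limsup_{n\to\infty}X_n=+\infty$ a.s.; (V) $\liminf_{x\to\infty}\underline{\mu}_2(x)>0$. Suppose also that for some $\theta>0$ and all $x$ sufficiently large, \[ 2x\underline{\mu}_1(x)\ge\left(1+\frac{1+\theta}{\log x}\right)\overline{\mu}_2(x). \] If also $\mathbb{E}X_0<\infty$, then there exists a constant $c>0$ such that $\mathbb{E}\,\#(\mathcal{C}_s\cap[0,x])\ge c\log\log x$ for all $x$ sufficiently large; in particular, $\mathbb{E}\,\#\mathcal{C}_s=\infty$.
   Context: $\mathbb{Z}_+=\{0,1,2,\dots\}$ and $\mathbb{R}_+=[0,\infty)$. $X=(X_n;n\in\mathbb{Z}_+)$ is a discrete-time stochastic process (not necessarily Markov) adapted to a filtration $(\mathcal{F}_n;n\in\mathbb{Z}_+)$, taking values in a measurable set $\mathcal{X}\subset\mathbb{R}_+$ with $\inf\mathcal{X}=0$ and $\sup\mathcal{X}=\infty$; $X_0$ may be random. Write $\Delta_n:=X_{n+1}-X_n$. For $k=1,2$, $\underline{\mu}_k,\overline{\mu}_k:\mathcal{X}\to\mathbb{R}$ are measurable functions such that, for all $n\in\mathbb{Z}_+$, $\underline{\mu}_k(X_n)\le\mathbb{E}(\Delta_n^k\mid\mathcal{F}_n)\le\overline{\mu}_k(X_n)$ a.s. Limits and inequalities for these functions are for $x\in\mathcal{X}$. $\#A$ is the number of elements of a set $A$. A point $x\in\mathbb{R}_+$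 is a strong cutpoint for $X$ if there exists $n_0\in\mathbb{Z}_+$ such that $X_n<x$ for all $n<n_0$, $X_{n_0}=x$, and $X_n>x$ for all $n>n_0$. $\mathcal{C}_s$ is the (random) set of strong cutpoints. *)

theory Defs
  imports "HOL-Probability.Probability"
begin

definition strong_cutpoint :: "(nat \<Rightarrow> real) \<Rightarrow> real \<Rightarrow> bool" where
  "strong_cutpoint u x \<longleftrightarrow> 0 \<le> x \<and>
     (\<exists>n0. (\<forall>n<n0. u n < x) \<and> u n0 = x \<and> (\<forall>n>n0. u n > x))"

definition strong_cutpoints :: "(nat \<Rightarrow> 'a \<Rightarrow> real) \<Rightarrow> 'a \<Rightarrow> real set" where
  "strong_cutpoints X \<omega> = {x. strong_cutpoint (\<lambda>n. X n \<omega>) x}"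

text \<open>The number of elements of an arbitrary set, with value \<open>\<infinity>\<close> for infinite sets
  (unlike \<^const>\<open>card\<close>, which is 0 there).\<close>

definition num_elements :: "'b set \<Rightarrow> ennreal" where
  "num_elements A = emeasure (count_space UNIV) A"

text \<open>The filter of \<open>x \<rightarrow> \<infinity>\<close> with \<open>x\<close> restricted to \<open>S\<close>.\<close>

abbreviation at_top_in :: "real set \<Rightarrow> real filter" where
  "at_top_in S \<equiv> inf at_top (principal S)"

end

theory Submission
  imports Defs "HOL-Real_Asymp.Real_Asymp"
begin

text \<open>For \<open>0 < \<gamma> < \<theta>\<close> the process \<open>(ln X\<^sub>n) powr (- \<gamma>)\<close> is a supermartingale as long as \<open>X\<^sub>n\<close>
  is large. At the first passage over a high level \<open>t\<close> the process sits at a strict record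
  \<open>y \<in> {t..t + B}\<close>. With probability bounded below it then jumps by at least a fixed \<open>\<epsilon>\<close>, and from
  \<open>y + \<epsilon>\<close> the supermartingale returns to \<open>{..y}\<close> with probability at most
  \<open>(ln (y + \<epsilon>) / ln y) powr (- \<gamma>)\<close>. Otherwise \<open>y\<close> is a strong cutpoint, so
  \<open>{t..t + B}\<close> contains a strong cutpoint with probability of order \<open>1 / (t ln t)\<close>, which is
  comparable to \<open>ln (ln (t + w)) - ln (ln t)\<close>; summing over \<open>t\<close> in an arithmetic progression
  with step \<open>w > B\<close> telescopes.\<close>

subsection \<open>A negative power of the logarithm as a Lyapunov function\<close>

definition log_potential :: "real \<Rightarrow> real \<Rightarrow> real" where
  "log_potential \<gamma> x = ln x powr (- \<gamma>)"

definition log_potential' :: "real \<Rightarrow> real \<Rightarrow> real" where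
  "log_potential' \<gamma> x = - \<gamma> * ln x powr (- \<gamma> - 1) / x"

definition log_potential'' :: "real \<Rightarrow> real \<Rightarrow> real" where
  "log_potential'' \<gamma> x =
    \<gamma> * ln x powr (- \<gamma> - 1) / x\<^sup>2 + \<gamma> * (\<gamma> + 1) * ln x powr (- \<gamma> - 2) / x\<^sup>2"

lemma log_potential_deriv:
  assumes "1 < x"
  shows "(log_potential \<gamma> has_real_derivative log_potential' \<gamma> x) (at x)"
proof -
  have "ln x > 0" using assms by simp
  then show ?thesis using assms unfolding log_potential_def[abs_def] log_potential'_def
    by (auto intro!: derivative_eq_intros simp: powr_diff field_simps)
qed

lemma log_potential'_deriv:
  assumes "1 < x"
  shows "(log_potential' \<gamma> has_real_derivative log_potential'' \<gamma> x) (at x)"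
proof -
  have ln: "ln x > 0" using assms by simp
  have powr: "((\<lambda>x. ln x powr (- \<gamma> - 1)) has_real_derivative
      (- \<gamma> - 1) * ln x powr (- \<gamma> - 2) * (1 / x)) (at x)"
    using DERIV_chain2[OF has_real_derivative_powr[OF ln, of "- \<gamma> - 1"] DERIV_ln_divide[of x]] assms
    by (simp add: algebra_simps)
  have "(log_potential' \<gamma> has_real_derivative
      (- \<gamma> * ((- \<gamma> - 1) * ln x powr (- \<gamma> - 2) * (1 / x)) * x - (- \<gamma> * ln x powr (- \<gamma> - 1)) * 1) / (x * x)) (at x)"
    using assms ln unfolding log_potential'_def[abs_def]
    by (intro DERIV_divide DERIV_cmult powr DERIV_ident) auto
  also have "(- \<gamma> * ((- \<gamma> - 1) * ln x powr (- \<gamma> - 2) * (1 / x)) * x - (- \<gamma> * ln x powr (- \<gamma> - 1)) * 1) / (x * x)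
    = log_potential'' \<gamma> x"
    using assms unfolding log_potential''_def by (simp add: field_simps power2_eq_square)
  finally show ?thesis .
qed

lemma log_potential_pos: "1 < x \<Longrightarrow> 0 < log_potential \<gamma> x"
  by (simp add: log_potential_def)

lemma log_potential_antimono:
  assumes "0 < \<gamma>" "1 < x" "x \<le> y"
  shows "log_potential \<gamma> y \<le> log_potential \<gamma> x"
  using assms unfolding log_potential_def by (intro powr_mono2') auto

lemma log_potential'_mono:
  assumes "0 < \<gamma>" "1 < x" "x \<le> y"
  shows "log_potential' \<gamma> x \<le> log_potential' \<gamma> y"
proof -
  have "\<gamma> * ln y powr (- \<gamma> - 1) / y \<le> \<gamma> * ln x powr (- \<gamma> - 1) / x"
    using assms by (intro frac_le mult_left_mono powr_mono2') auto
  then show ?thesis by (simp add: log_potential'_def)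
qed

lemma log_potential''_antimono:
  assumes "0 < \<gamma>" "1 < x" "x \<le> y"
  shows "log_potential'' \<gamma> y \<le> log_potential'' \<gamma> x"
  using assms unfolding log_potential''_def
  by (intro add_mono frac_le mult_left_mono powr_mono2' power_mono) auto

lemma log_potential'_neg: "0 < \<gamma> \<Longrightarrow> 1 < x \<Longrightarrow> log_potential' \<gamma> x < 0"
  by (simp add: log_potential'_def)

lemma log_potential''_pos: "0 < \<gamma> \<Longrightarrow> 1 < x \<Longrightarrow> 0 < log_potential'' \<gamma> x"
  unfolding log_potential''_def by (intro add_pos_pos divide_pos_pos mult_pos_pos) auto

text \<open>Taylor's formula of order two with Lagrange remainder: the intermediate point is at
  least \<open>x - B\<close>, and the second derivative is decreasing, so its value at
  \<open>x - B\<close> bounds the remainder for every admissible \<open>d\<close> at once.\<close>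

lemma log_potential_taylor:
  assumes \<gamma>: "0 < \<gamma>" and x: "1 < x - B" and d: "\<bar>d\<bar> \<le> B"
  shows "log_potential \<gamma> (x + d) \<le>
    log_potential \<gamma> x + log_potential' \<gamma> x * d + log_potential'' \<gamma> (x - B) / 2 * d\<^sup>2"
proof (cases "d = 0")
  case False
  \<comment> \<open>Only the orders 0, 1 and 2 enter the expansion, so the value for larger
    \<open>m\<close> is a dummy. The case \<open>d = 0\<close> is separate because Taylor's theorem
    wants two distinct points.\<close>
  define diff where "diff m = (if m = 0 then log_potential \<gamma> else
    if m = 1 then log_potential' \<gamma> else log_potential'' \<gamma>)" for m :: nat
  have "DERIV (diff m) t :> diff (Suc m) t" if "m < 2" "x - B \<le> t" for m t
    using that x log_potential_deriv[of t \<gamma>] log_potential'_deriv[of t \<gamma>]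
    by (auto simp: diff_def less_2_cases_iff)
  then have "\<exists>t. (if x + d < x then x + d < t \<and> t < x else x < t \<and> t < x + d) \<and>
      log_potential \<gamma> (x + d) = (\<Sum>m<2. diff m x / fact m * (x + d - x) ^ m)
        + diff 2 t / fact 2 * (x + d - x) ^ 2"
    using d False by (intro Taylor[of _ _ _ "x - B" "x + B"]) (auto simp: diff_def)
  then obtain t where t: "if x + d < x then x + d < t \<and> t < x else x < t \<and> t < x + d" and eq: "log_potential \<gamma> (x + d) =
      (\<Sum>m<2. diff m x / fact m * (x + d - x) ^ m) + diff 2 t / fact 2 * (x + d - x) ^ 2"
    by auto
  have t: "x - B \<le> t" using t d by (auto split: if_splits)
  have "log_potential'' \<gamma> t / 2 * d\<^sup>2 \<le> log_potential'' \<gamma> (x - B) / 2 * d\<^sup>2"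
    using log_potential''_antimono[OF \<gamma> x t] by (intro mult_right_mono) auto
  then show ?thesis using eq by (simp add: diff_def numeral_2_eq_2)
qed simp

text \<open>Mean value theorem together with the monotonicity of the derivative. Leaving
  \<open>z\<close> free allows one \<open>z\<close> to serve for all \<open>y\<close> in a whole
  interval.\<close>

lemma log_potential_decrease:
  assumes \<gamma>: "0 < \<gamma>" and y: "1 < y" and \<epsilon>: "0 < \<epsilon>" and z: "y + \<epsilon> \<le> z"
  shows "\<epsilon> * - log_potential' \<gamma> z \<le> log_potential \<gamma> y - log_potential \<gamma> (y + \<epsilon>)"
proof -
  have "\<exists>t. y < t \<and> t < y + \<epsilon> \<and> log_potential \<gamma> (y + \<epsilon>) - log_potential \<gamma> y =
      (y + \<epsilon> - y) * log_potential' \<gamma> t"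
    using y \<epsilon> by (intro MVT2 log_potential_deriv) auto
  then obtain t where t: "y < t" "t < y + \<epsilon>"
    and eq: "log_potential \<gamma> (y + \<epsilon>) - log_potential \<gamma> y = \<epsilon> * log_potential' \<gamma> t"
    by auto
  have "\<epsilon> * log_potential' \<gamma> t \<le> \<epsilon> * log_potential' \<gamma> z"
    using t y z \<epsilon> \<gamma> by (intro mult_left_mono log_potential'_mono) auto
  then show ?thesis using eq by simp
qed

text \<open>The right side is asymptotic to \<open>\<gamma> / (x * ln x)\<close>, the left side to
  half of that; the factor 2 in the denominator is this slack.\<close>

lemma log_log_increment_eventually:
  assumes "0 < \<gamma>" "0 < w" "0 < a"
  shows "\<forall>\<^sub>F x in at_top. \<gamma> / (2 * w) * (ln (ln (x + w)) - ln (ln x)) \<le>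
    - log_potential' \<gamma> (x + a) / log_potential \<gamma> x"
  using assms unfolding log_potential'_def log_potential_def by real_asymp

lemma log_potential_measurable [measurable]: "log_potential \<gamma> \<in> borel_measurable borel"
  unfolding log_potential_def by measurable

lemma log_potential'_measurable [measurable]: "log_potential' \<gamma> \<in> borel_measurable borel"
  unfolding log_potential'_def by measurable

lemma log_potential''_measurable [measurable]: "log_potential'' \<gamma> \<in> borel_measurable borel"
  unfolding log_potential''_def by measurable

text \<open>With \<open>r = (1 + (1 + \<theta>) / ln x) / x\<close> the drift condition reads
  \<open>m1 \<ge> r * u2 / 2\<close>. As the first derivative is negative, the first-order term is
  then at most \<open>r * log_potential' \<gamma> x * u2 / 2\<close>, which compensates the
  second-order term by \<open>pot\<close>. In the application \<open>m1\<close> and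
  \<open>m2\<close> are the conditional moments at one sample point.\<close>

lemma log_potential_drift:
  assumes \<gamma>: "0 < \<gamma>" and \<theta>: "0 < \<theta>" and x: "1 < x - B" "0 \<le> B"
    and pot: "log_potential'' \<gamma> (x - B) \<le> (1 + (1 + \<theta>) / ln x) / x * - log_potential' \<gamma> x"
    and m: "m1 \<ge> l1" "m2 \<le> u2" "0 \<le> m2"
    and low: "2 * x * l1 \<ge> (1 + (1 + \<theta>) / ln x) * u2"
  shows "0 \<le> m1" and "log_potential' \<gamma> x * m1 + log_potential'' \<gamma> (x - B) / 2 * m2 \<le> 0"
proof -
  have x1: "1 < x" using x by simp
  define r where "r = (1 + (1 + \<theta>) / ln x) / x"
  have r0: "0 \<le> r" using x1 \<theta> by (simp add: r_def)
  have "r * u2 \<le> 2 * l1" using low x1 by (simp add: r_def field_simps)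
  then have m1: "r * u2 / 2 \<le> m1" using m by linarith
  have u2: "0 \<le> u2" using m by linarith
  then have "0 \<le> r * u2 / 2" using r0 by simp
  then show "0 \<le> m1" using m1 by linarith
  have "log_potential' \<gamma> x * m1 \<le> log_potential' \<gamma> x * (r * u2 / 2)"
    using m1 log_potential'_neg[OF \<gamma> x1] by (intro mult_left_mono_neg) auto
  moreover have "log_potential'' \<gamma> (x - B) / 2 * m2 \<le> (r * - log_potential' \<gamma> x) / 2 * u2"
    using m u2 pot log_potential''_pos[OF \<gamma> x(1)] unfolding r_def[symmetric]
    by (intro mult_mono) auto
  ultimately show "log_potential' \<gamma> x * m1 + log_potential'' \<gamma> (x - B) / 2 * m2 \<le> 0"
    by (simp add: algebra_simps)
qed

text \<open>A shift by \<open>w\<close> does not change the growth of \<open>ln (ln x)\<close>, and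
  halving the constant absorbs the fixed loss \<open>a\<close>.\<close>

lemma log_log_tail_eventually:
  fixes a c w :: real
  assumes "0 < c"
  shows "\<forall>\<^sub>F x in at_top. c / 2 * ln (ln x) \<le> c * (ln (ln (x - w)) - a)"
  using assms by real_asymp

lemma log_log_exceeds_eventually:
  fixes c r :: real
  assumes "0 < c"
  shows "\<forall>\<^sub>F x in at_top. r < c * ln (ln x)"
  using assms by real_asymp

text \<open>Without the shift by \<open>B\<close> both sides share the factor
  \<open>\<gamma> * ln x powr (- \<gamma> - 1) / x\<^sup>2\<close>, and it remains to compare
  \<open>1 + (\<gamma> + 1) / ln x\<close> with \<open>1 + (1 + \<theta>) / ln x\<close>. Since
  \<open>\<gamma> < \<theta>\<close> the gap is of order \<open>1 / ln x\<close>, while the shift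
  causes only a relative error of order \<open>1 / x\<close>.\<close>

lemma log_potential_drift_eventually:
  assumes \<gamma>: "0 < \<gamma>" "\<gamma> \<le> 1" "\<gamma> < \<theta>" and B: "0 \<le> B"
  shows "\<forall>\<^sub>F x in at_top. log_potential'' \<gamma> (x - B) \<le>
    (1 + (1 + \<theta>) / ln x) / x * - log_potential' \<gamma> x"
proof -
  \<comment> \<open>\<open>?e\<close> is the relative error caused by the shift in the leading term,
    multiplied by \<open>ln x\<close>; \<open>?r\<close> is the corresponding ratio in the
    lower-order term. In the limit the comparison becomes
    \<open>\<gamma> + 1 < 1 + \<theta>\<close>.\<close>
  let ?e = "\<lambda>x. ln x * ((ln x / ln (x - B))\<^sup>2 * (x / (x - B))\<^sup>2 - 1)"
  let ?r = "\<lambda>x. (ln x / ln (x - B)) ^ 3 * (x / (x - B))\<^sup>2"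
  have "(?e \<longlongrightarrow> 0) at_top" "(?r \<longlongrightarrow> 1) at_top"
    by real_asymp+
  then have "((\<lambda>x. ?e x + (\<gamma> + 1) * ?r x) \<longlongrightarrow> 0 + (\<gamma> + 1) * 1) at_top"
    by (intro tendsto_intros)
  then have "\<forall>\<^sub>F x in at_top. ?e x + (\<gamma> + 1) * ?r x < 1 + \<theta>"
    using \<gamma> by (intro order_tendstoD(2)) auto
  moreover have "\<forall>\<^sub>F x in at_top. 1 + B < x"
    by (rule eventually_gt_at_top)
  ultimately show ?thesis
  proof eventually_elim
    case (elim x)
    define L where "L = ln x"
    define M where "M = ln (x - B)"
    have x: "0 < x" "0 < x - B" and M: "0 < M" "M \<le> L"
      using elim(2) B by (auto simp: L_def M_def)
    define Q where "Q = (x / (x - B))\<^sup>2"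
    have "(L / M) ^ 3 / L = (L / M)\<^sup>2 / M"
      using M by (simp add: power2_eq_square power3_eq_cube)
    then have "(L / M)\<^sup>2 * Q * (1 + (\<gamma> + 1) / M) =
        (L / M)\<^sup>2 * Q + (\<gamma> + 1) * ((L / M) ^ 3 / L) * Q"
      by (simp add: algebra_simps)
    also have "\<dots> = 1 + (?e x + (\<gamma> + 1) * ?r x) / L"
      using M unfolding L_def[symmetric] M_def[symmetric] Q_def[symmetric]
      by (simp add: add_divide_distrib)
    also have "\<dots> \<le> 1 + (1 + \<theta>) / L"
      using elim(1) M by (intro add_left_mono divide_right_mono) auto
    finally have main: "(L / M)\<^sup>2 * Q * (1 + (\<gamma> + 1) / M) \<le> 1 + (1 + \<theta>) / L" .
    \<comment> \<open>Here \<open>\<gamma> \<le> 1\<close> and \<open>L / M \<ge> 1\<close> replace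
      the real exponent \<open>\<gamma> + 1\<close> by 2, which matches the powers in
      \<open>?e\<close> and \<open>?r\<close>.\<close>
    have "M powr (- \<gamma> - 1) = (L / M) powr (\<gamma> + 1) * L powr (- \<gamma> - 1)"
      using M by (simp add: powr_divide powr_minus[of _ "\<gamma> + 1", simplified] field_simps)
    also have "\<dots> \<le> (L / M) powr 2 * L powr (- \<gamma> - 1)"
      using M \<gamma> by (intro mult_right_mono powr_mono) auto
    also have "(L / M) powr 2 = (L / M)\<^sup>2"
      using M by simp
    finally have le: "M powr (- \<gamma> - 1) \<le> (L / M)\<^sup>2 * L powr (- \<gamma> - 1)" .
    have "M powr (- \<gamma> - 2) = M powr (- \<gamma> - 1) / M"
      using M powr_diff[of M "- \<gamma> - 1" 1] by (simp add: algebra_simps)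
    then have "log_potential'' \<gamma> (x - B) =
        \<gamma> * M powr (- \<gamma> - 1) / (x - B)\<^sup>2 + \<gamma> * (\<gamma> + 1) * (M powr (- \<gamma> - 1) / M) / (x - B)\<^sup>2"
      by (simp only: log_potential''_def M_def[symmetric])
    also have "\<dots> =
        M powr (- \<gamma> - 1) * (\<gamma> / (x - B)\<^sup>2 * (1 + (\<gamma> + 1) / M))"
      using M x by (simp add: divide_simps) (simp add: algebra_simps)
    also have "\<dots> \<le> (L / M)\<^sup>2 * L powr (- \<gamma> - 1) * (\<gamma> / (x - B)\<^sup>2 * (1 + (\<gamma> + 1) / M))"
      using le M \<gamma> by (intro mult_right_mono) auto
    also have "\<dots> = \<gamma> * L powr (- \<gamma> - 1) / x\<^sup>2 *
        ((L / M)\<^sup>2 * Q * (1 + (\<gamma> + 1) / M))"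
      using x by (simp add: Q_def power_divide)
    also have "\<dots> \<le> \<gamma> * L powr (- \<gamma> - 1) / x\<^sup>2 * (1 + (1 + \<theta>) / L)"
      using main \<gamma> by (intro mult_left_mono) auto
    also have "\<dots> = (1 + (1 + \<theta>) / ln x) / x * - log_potential' \<gamma> x"
      by (simp add: log_potential'_def L_def power2_eq_square)
    finally show ?case .
  qed
qed

subsection \<open>Processes with bounded increments\<close>

lemma limsup_infinity_imp_exceeds:
  fixes u :: "nat \<Rightarrow> real"
  assumes "limsup (\<lambda>n. ereal (u n)) = \<infinity>"
  shows "\<exists>n. t \<le> u n"
proof (rule ccontr)
  assume "\<nexists>n. t \<le> u n"
  then have "limsup (\<lambda>n. ereal (u n)) \<le> ereal t"
    by (intro Limsup_bounded always_eventually) (simp add: not_le less_imp_le)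
  then show False using assms by simp
qed

text \<open>Continuity of the measure from below. It handles the random starting point: a first
  passage over \<open>t\<close> from below requires a path that starts below
  \<open>t\<close>.\<close>

lemma (in prob_space) prob_less_ge_half:
  assumes [measurable]: "Z \<in> borel_measurable M"
  obtains t :: real where "\<And>s. t \<le> s \<Longrightarrow> 1 / 2 \<le> prob {\<omega> \<in> space M. Z \<omega> < s}"
proof -
  let ?A = "\<lambda>n. {\<omega> \<in> space M. Z \<omega> < real n}"
  have "(\<lambda>n. prob (?A n)) \<longlonglongrightarrow> prob (\<Union>n. ?A n)"
    by (rule finite_Lim_measure_incseq) (auto simp: incseq_def)
  also have "(\<Union>n. ?A n) = space M"
  proof
    show "space M \<subseteq> (\<Union>n. ?A n)"
    proof
      fix \<omega> assume "\<omega> \<in> space M"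
      moreover obtain n where "Z \<omega> < real n" using reals_Archimedean2 by blast
      ultimately show "\<omega> \<in> (\<Union>n. ?A n)" by blast
    qed
  qed blast
  finally have "(\<lambda>n. prob (?A n)) \<longlonglongrightarrow> 1" by (simp add: prob_space)
  then have "\<forall>\<^sub>F n in sequentially. 1 / 2 < prob (?A n)"
    by (rule order_tendstoD) simp
  then obtain n where n: "1 / 2 < prob (?A n)" by (auto simp: eventually_sequentially)
  show ?thesis
  proof
    fix s assume "real n \<le> s"
    then have "prob (?A n) \<le> prob {\<omega> \<in> space M. Z \<omega> < s}"
      by (intro finite_measure_mono) auto
    then show "1 / 2 \<le> prob {\<omega> \<in> space M. Z \<omega> < s}" using n by simp
  qed
qed

locale bounded_increments = prob_space M for M :: "'a measure" +
  fixes F :: "nat \<Rightarrow> 'a measure" and X :: "nat \<Rightarrow> 'a \<Rightarrow> real" and B :: real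
  assumes filtration: "filtration (space M) F"
    and subalg: "\<And>n. subalgebra M (F n)"
    and adapted: "\<And>n. X n \<in> borel_measurable (F n)"
    and B_pos: "0 < B"
    and bounded_increment: "\<And>n. AE \<omega> in M. \<bar>X (Suc n) \<omega> - X n \<omega>\<bar> \<le> B"
begin

abbreviation increment_moment :: "nat \<Rightarrow> nat \<Rightarrow> 'a \<Rightarrow> real" where
  "increment_moment k n \<equiv> real_cond_exp M (F n) (\<lambda>\<omega>. (X (Suc n) \<omega> - X n \<omega>) ^ k)"

lemma B_nonneg: "0 \<le> B"
  using B_pos by simp

lemma space_F: "space (F n) = space M"
  using subalg[of n] by (simp add: subalgebra_def)

lemma sets_F_mono: "m \<le> n \<Longrightarrow> G \<in> sets (F m) \<Longrightarrow> G \<in> sets (F n)"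
  using filtration.sets_F_mono[OF filtration] by blast

lemma sets_F_M: "G \<in> sets (F n) \<Longrightarrow> G \<in> sets M"
  using subalg[of n] by (auto simp: subalgebra_def)

lemma measurable_F_mono:
  "m \<le> n \<Longrightarrow> f \<in> borel_measurable (F m) \<Longrightarrow> f \<in> borel_measurable (F n)"
  by (rule measurable_from_subalg[of "F n" "F m"])
    (simp_all add: subalgebra_def space_F subsetI sets_F_mono)

lemma adapted_le: "m \<le> n \<Longrightarrow> X m \<in> borel_measurable (F n)"
  using measurable_F_mono adapted by blast

lemma X_measurable [measurable]: "X n \<in> borel_measurable M"
  using measurable_from_subalg[OF subalg adapted] .

lemma sigma_finite_subalgebra_F: "sigma_finite_subalgebra M (F n)"
proof -
  interpret finite_measure_subalgebra M "F n"
    by unfold_locales (rule subalg)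
  show ?thesis by unfold_locales
qed

text \<open>A bounded \<open>F n\<close>-measurable weight can be pulled through the conditional
  expectation, and bounded increments make all products integrable. This transfers pointwise bounds
  on conditional moments to integrals of the increments themselves.\<close>

lemma increment_moment_integral:
  assumes a: "a \<in> borel_measurable (F n)" and aK: "AE \<omega> in M. \<bar>a \<omega>\<bar> \<le> K"
  shows "integrable M (\<lambda>\<omega>. a \<omega> * (X (Suc n) \<omega> - X n \<omega>) ^ k)"
    and "integrable M (\<lambda>\<omega>. a \<omega> * increment_moment k n \<omega>)"
    and "(\<integral>\<omega>. a \<omega> * increment_moment k n \<omega> \<partial>M) =
      (\<integral>\<omega>. a \<omega> * (X (Suc n) \<omega> - X n \<omega>) ^ k \<partial>M)"
proof -
  interpret S: sigma_finite_subalgebra M "F n" by (rule sigma_finite_subalgebra_F)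
  have aM [measurable]: "a \<in> borel_measurable M"
    using measurable_from_subalg[OF subalg a] .
  show 1: "integrable M (\<lambda>\<omega>. a \<omega> * (X (Suc n) \<omega> - X n \<omega>) ^ k)"
  proof (rule integrable_const_bound[of _ "K * B ^ k"])
    show "AE \<omega> in M. norm (a \<omega> * (X (Suc n) \<omega> - X n \<omega>) ^ k) \<le> K * B ^ k"
      using aK bounded_increment[of n]
    proof eventually_elim
      case (elim \<omega>)
      have "\<bar>X (Suc n) \<omega> - X n \<omega>\<bar> ^ k \<le> B ^ k"
        using elim(2) by (intro power_mono) auto
      then show ?case
        using elim(1) by (auto simp: abs_mult power_abs intro!: mult_mono)
    qed
  qed simp
  show "integrable M (\<lambda>\<omega>. a \<omega> * increment_moment k n \<omega>)"
    by (rule S.real_cond_exp_intg(1)[OF 1 a]) simp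
  show "(\<integral>\<omega>. a \<omega> * increment_moment k n \<omega> \<partial>M) =
      (\<integral>\<omega>. a \<omega> * (X (Suc n) \<omega> - X n \<omega>) ^ k \<partial>M)"
    by (rule S.real_cond_exp_intg(2)[OF 1 a]) simp
qed

text \<open>The variable \<open>\<Delta> (\<Delta> + B)\<close> has conditional mean at least \<open>\<delta>\<close>, but it is nonpositive
  for \<open>-B \<le> \<Delta> \<le> 0\<close> and small for \<open>0 \<le> \<Delta> \<le> \<epsilon>\<close>.\<close>

lemma prob_jump_up:
  assumes G: "G \<in> sets (F n)"
    and drift: "AE \<omega> in M. \<omega> \<in> G \<longrightarrow>
      0 \<le> increment_moment 1 n \<omega> \<and> \<delta> \<le> increment_moment 2 n \<omega>"
    and \<epsilon>: "0 < \<epsilon>" "\<epsilon> * (\<epsilon> + B) \<le> \<delta> / 2"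
  shows "\<delta> / 2 * prob G \<le>
    2 * B\<^sup>2 * prob {\<omega> \<in> G. X (Suc n) \<omega> > X n \<omega> + \<epsilon>}"
proof -
  define J where "J = {\<omega> \<in> G. X (Suc n) \<omega> > X n \<omega> + \<epsilon>}"
  have GM [measurable]: "G \<in> sets M" using sets_F_M[OF G] .
  have "J = G \<inter> {\<omega> \<in> space M. X (Suc n) \<omega> > X n \<omega> + \<epsilon>}"
    unfolding J_def using sets.sets_into_space[OF GM] by auto
  then have JM [measurable]: "J \<in> sets M" by simp
  let ?\<Delta> = "\<lambda>\<omega>. X (Suc n) \<omega> - X n \<omega>"
  have a: "(\<lambda>\<omega>. c * indicat_real G \<omega>) \<in> borel_measurable (F n)" for c
    using G by measurable
  have b: "AE \<omega> in M. \<bar>c * indicat_real G \<omega>\<bar> \<le> \<bar>c\<bar>" for c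
    by (auto simp: indicator_def)
  note m1 = increment_moment_integral[OF a[of B] b, of 1]
  note m2 = increment_moment_integral[OF a[of 1] b, of 2]
  have "\<delta> * prob G = (\<integral>\<omega>. \<delta> * indicat_real G \<omega> \<partial>M)"
    by simp
  also have "\<dots> \<le> (\<integral>\<omega>. B * indicat_real G \<omega> * increment_moment 1 n \<omega>
      + 1 * indicat_real G \<omega> * increment_moment 2 n \<omega> \<partial>M)"
  proof (rule integral_mono_AE)
    show "integrable M (\<lambda>\<omega>. \<delta> * indicat_real G \<omega>)"
      by (intro integrable_mult_right integrable_real_indicator) (auto simp: emeasure_eq_measure)
    show "AE \<omega> in M. \<delta> * indicat_real G \<omega> \<le> B * indicat_real G \<omega> * increment_moment 1 n \<omega>
      + 1 * indicat_real G \<omega> * increment_moment 2 n \<omega>"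
      using drift
    proof eventually_elim
      case (elim \<omega>)
      then show ?case using B_nonneg
        by (auto simp: indicator_def intro!: add_increasing)
    qed
  qed (intro Bochner_Integration.integrable_add m1(2) m2(2))
  also have "\<dots> = (\<integral>\<omega>. B * indicat_real G \<omega> * ?\<Delta> \<omega> ^ 1
      + 1 * indicat_real G \<omega> * ?\<Delta> \<omega> ^ 2 \<partial>M)"
    using m1 m2 by (simp add: Bochner_Integration.integral_add)
  also have "\<dots> \<le> (\<integral>\<omega>. \<delta> / 2 * indicat_real G \<omega> + 2 * B\<^sup>2 * indicat_real J \<omega> \<partial>M)"
  proof (rule integral_mono_AE)
    show "integrable M (\<lambda>\<omega>. \<delta> / 2 * indicat_real G \<omega> + 2 * B\<^sup>2 * indicat_real J \<omega>)"
      by (intro Bochner_Integration.integrable_add integrable_mult_right integrable_real_indicator)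
        (auto simp: emeasure_eq_measure)
    show "AE \<omega> in M. B * indicat_real G \<omega> * ?\<Delta> \<omega> ^ 1 + 1 * indicat_real G \<omega> * ?\<Delta> \<omega> ^ 2
       \<le> \<delta> / 2 * indicat_real G \<omega> + 2 * B\<^sup>2 * indicat_real J \<omega>"
      using bounded_increment[of n]
    proof eventually_elim
      case (elim \<omega>)
      define d where "d = ?\<Delta> \<omega>"
      have d: "-B \<le> d" "d \<le> B" using elim by (auto simp: d_def)
      have "0 \<le> \<epsilon> * (\<epsilon> + B)"
        using \<epsilon>(1) B_nonneg by simp
      then have \<delta>: "0 \<le> \<delta> / 2" using \<epsilon>(2) by linarith
      \<comment> \<open>The constant \<open>2 * B\<^sup>2\<close> is the maximum of
        \<open>d * (d + B)\<close> over \<open>\<bar>d\<bar> \<le> B\<close>, attained at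
        \<open>d = B\<close>.\<close>
      have ineq: "B * d + d\<^sup>2 \<le> \<delta> / 2 + (if d > \<epsilon> then 2 * B\<^sup>2 else 0)"
      proof -
        have eq: "B * d + d\<^sup>2 = d * (d + B)" by (simp add: power2_eq_square algebra_simps)
        consider "d > \<epsilon>" | "0 \<le> d" "d \<le> \<epsilon>" | "d < 0" by linarith
        then show ?thesis
        proof cases
          case 1
          have "d * (d + B) \<le> B * (B + B)"
            using d 1 \<epsilon> by (intro mult_mono) auto
          then show ?thesis using 1 \<delta> eq by (simp add: power2_eq_square)
        next
          case 2
          have "d * (d + B) \<le> \<epsilon> * (\<epsilon> + B)"
            using d 2 \<epsilon> B_nonneg by (intro mult_mono) auto
          then show ?thesis using 2 \<epsilon> eq by simp
        next
          case 3
          have "d * (d + B) \<le> 0"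
            using d 3 by (intro mult_nonpos_nonneg) auto
          then show ?thesis using 3 \<delta> eq \<epsilon> by auto
        qed
      qed
      have "\<omega> \<in> J \<longleftrightarrow> \<omega> \<in> G \<and> d > \<epsilon>" by (auto simp: J_def d_def)
      then show ?case using ineq by (auto simp: indicator_def d_def[symmetric])
    qed
  qed (intro Bochner_Integration.integrable_add m1(1) m2(1))
  also have "\<dots> = \<delta> / 2 * prob G + 2 * B\<^sup>2 * prob J"
    by (subst Bochner_Integration.integral_add)
      (auto intro!: integrable_mult_right integrable_real_indicator simp: emeasure_eq_measure)
  finally show ?thesis unfolding J_def by simp
qed

text \<open>The cutpoint is described through the time \<open>n\<close> of its visit rather than
  through its value, so that only countable quantifiers occur and the event is measurable.\<close>

definition cutpoint_event :: "real \<Rightarrow> 'a set" where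
  "cutpoint_event t = {\<omega> \<in> space M. \<exists>n. (\<forall>m<n. X m \<omega> < X n \<omega>) \<and>
    t \<le> X n \<omega> \<and> X n \<omega> \<le> t + B \<and> (\<forall>m>n. X n \<omega> < X m \<omega>)}"

lemma cutpoint_event_measurable [measurable]: "cutpoint_event t \<in> sets M"
  unfolding cutpoint_event_def by measurable

text \<open>As \<open>w\<close> exceeds \<open>B\<close>, the intervals of length \<open>B\<close>
  that start at the points \<open>t + real k * w\<close> are disjoint, so different events yield
  different cutpoints and the counting measure adds up. For \<open>k < N\<close> each interval ends
  before \<open>t + real N * w\<close>, hence inside \<open>{0..x}\<close>.\<close>

lemma num_strong_cutpoints_ge:
  assumes t: "0 \<le> t" and w: "B < w" and x: "t + real N * w \<le> x"
  shows "(\<Sum>k<N. indicator (cutpoint_event (t + real k * w)) \<omega>) \<le>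
    num_elements (strong_cutpoints X \<omega> \<inter> {0..x})"
proof -
  define s where "s k = t + real k * w" for k
  define I where "I k = strong_cutpoints X \<omega> \<inter> {s k..s k + B}" for k
  have s_less: "s j + B < s k" if "j < k" for j k
  proof -
    have "(real j + 1) * w \<le> real k * w"
      using that w B_pos by (intro mult_right_mono) auto
    then show ?thesis using w by (simp add: s_def algebra_simps)
  qed
  have "disjoint_family I"
    unfolding disjoint_family_on_def
  proof (intro ballI impI)
    fix j k :: nat assume "j \<noteq> k"
    then have "s j + B < s k \<or> s k + B < s j" using s_less[of j k] s_less[of k j] by linarith
    then show "I j \<inter> I k = {}" by (auto simp: I_def)
  qed
  then have disj: "disjoint_family_on I {..<N}"
    by (rule disjoint_family_on_mono[OF subset_UNIV])
  have "indicator (cutpoint_event (s k)) \<omega> \<le> emeasure (count_space UNIV) (I k)" for k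
  proof (cases "\<omega> \<in> cutpoint_event (s k)")
    case True
    then obtain n where n: "\<forall>m<n. X m \<omega> < X n \<omega>" "s k \<le> X n \<omega>" "X n \<omega> \<le> s k + B"
      "\<forall>m>n. X n \<omega> < X m \<omega>" by (auto simp: cutpoint_event_def)
    have "0 \<le> s k" using t w B_pos by (simp add: s_def)
    with n have "X n \<omega> \<in> I k"
      by (auto simp: I_def strong_cutpoints_def strong_cutpoint_def)
    then have "emeasure (count_space UNIV) {X n \<omega>} \<le> emeasure (count_space UNIV) (I k)"
      by (intro emeasure_mono) auto
    then show ?thesis using True by simp
  qed simp
  then have "(\<Sum>k<N. indicator (cutpoint_event (s k)) \<omega>) \<le>
      (\<Sum>k<N. emeasure (count_space UNIV) (I k))"
    by (rule sum_mono)
  also have "\<dots> = emeasure (count_space UNIV) (\<Union>k<N. I k)"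
    using disj by (intro sum_emeasure) auto
  also have "\<dots> \<le> emeasure (count_space UNIV) (strong_cutpoints X \<omega> \<inter> {0..x})"
  proof (intro emeasure_mono)
    have "s k + B \<le> x" "0 \<le> s k" if "k < N" for k
      using s_less[OF that] x t w B_pos by (auto simp: s_def)
    then show "(\<Union>k<N. I k) \<subseteq> strong_cutpoints X \<omega> \<inter> {0..x}"
      by (force simp: I_def)
  qed simp
  finally show ?thesis by (simp add: s_def num_elements_def)
qed

text \<open>Summing the bounds \<open>prob\<close> along an arithmetic progression of step
  \<open>w\<close> telescopes in \<open>g\<close>. The last point of the progression lies within
  \<open>w\<close> of \<open>x\<close>, whence the argument \<open>x - w\<close>.\<close>

lemma expected_strong_cutpoints_ge:
  assumes t: "0 \<le> t" and w: "B < w" and c: "0 \<le> c" and x: "t + w \<le> x"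
    and prob: "\<And>s. t \<le> s \<Longrightarrow> c * (g (s + w) - g s) \<le> prob (cutpoint_event s)"
    and g: "\<And>s r. t \<le> s \<Longrightarrow> s \<le> r \<Longrightarrow> g s \<le> g r"
  shows "ennreal (c * (g (x - w) - g t)) \<le>
    (\<integral>\<^sup>+ \<omega>. num_elements (strong_cutpoints X \<omega> \<inter> {0..x}) \<partial>M)"
proof -
  define N where "N = nat \<lfloor>(x - t) / w\<rfloor>"
  have w0: "0 < w" using w B_pos by simp
  have "t \<le> x" using x w0 by simp
  then have N: "real N \<le> (x - t) / w" "(x - t) / w < real N + 1"
    using w0 by (simp_all add: N_def)
  have Nx: "t + real N * w \<le> x" "x - w \<le> t + real N * w"
    using N w0 by (simp_all add: field_simps)
  have "c * (g (x - w) - g t) \<le> c * (g (t + real N * w) - g t)"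
    using c g[OF _ Nx(2)] x by (intro mult_left_mono) auto
  also have "\<dots> = (\<Sum>k<N. c * (g (t + real k * w + w) - g (t + real k * w)))"
  proof -
    have "(\<Sum>k<N. g (t + real k * w + w) - g (t + real k * w)) = g (t + real N * w) - g t"
      using sum_lessThan_telescope[of "\<lambda>k. g (t + real k * w)" N] by (simp add: algebra_simps)
    then show ?thesis by (simp only: sum_distrib_left[symmetric])
  qed
  also have "\<dots> \<le> (\<Sum>k<N. prob (cutpoint_event (t + real k * w)))"
    using w0 by (intro sum_mono prob) auto
  finally have "ennreal (c * (g (x - w) - g t)) \<le>
      ennreal (\<Sum>k<N. prob (cutpoint_event (t + real k * w)))"
    by (rule ennreal_leI)
  also have "\<dots> = (\<Sum>k<N. emeasure M (cutpoint_event (t + real k * w)))"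
    by (simp add: emeasure_eq_measure sum_ennreal)
  also have "\<dots> = (\<integral>\<^sup>+ \<omega>. (\<Sum>k<N. indicator (cutpoint_event (t + real k * w)) \<omega>) \<partial>M)"
    by (simp add: nn_integral_sum)
  \<comment> \<open>The comparison is pointwise, and the non-negative integral is monotone for
    arbitrary functions, so it applies directly to the random count.\<close>
  also have "\<dots> \<le> (\<integral>\<^sup>+ \<omega>. num_elements (strong_cutpoints X \<omega> \<inter> {0..x}) \<partial>M)"
    by (intro nn_integral_mono num_strong_cutpoints_ge t w Nx)
  finally show ?thesis .
qed

end

subsection \<open>Escape probabilities\<close>

text \<open>Only a second-order upper bound is asked of \<open>f\<close>: \<open>f1\<close> and
  \<open>f2\<close> are coefficients, and \<open>f2\<close> may contain the Taylor remainder.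
  Positivity and monotonicity start at \<open>x0 - B\<close> because one step from a point above
  \<open>x0\<close> can lead down to there.\<close>

locale lyapunov = bounded_increments +
  fixes f f1 f2 :: "real \<Rightarrow> real" and x0 K :: real
  assumes f_measurable [measurable]: "f \<in> borel_measurable borel"
    and f1_measurable [measurable]: "f1 \<in> borel_measurable borel"
    and f2_measurable [measurable]: "f2 \<in> borel_measurable borel"
    and f_pos: "\<And>x. x0 - B \<le> x \<Longrightarrow> 0 < f x"
    and f_antimono: "\<And>x y. x0 - B \<le> x \<Longrightarrow> x \<le> y \<Longrightarrow> f y \<le> f x"
    and f1_bound: "\<And>x. x0 \<le> x \<Longrightarrow> \<bar>f1 x\<bar> \<le> K"
    and f2_bound: "\<And>x. x0 \<le> x \<Longrightarrow> \<bar>f2 x\<bar> \<le> K"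
    and taylor: "\<And>x d. x0 \<le> x \<Longrightarrow> \<bar>d\<bar> \<le> B \<Longrightarrow> f (x + d) \<le> f x + f1 x * d + f2 x * d\<^sup>2"
    and drift: "\<And>n. AE \<omega> in M. x0 \<le> X n \<omega> \<longrightarrow>
      f1 (X n \<omega>) * increment_moment 1 n \<omega> + f2 (X n \<omega>) * increment_moment 2 n \<omega> \<le> 0"
begin

text \<open>On \<open>G\<close> the process is at least \<open>x0\<close> now and almost surely at
  least \<open>x0 - B\<close> one step later, so \<open>f\<close> is at most
  \<open>f (x0 - B)\<close> at both times. Empty \<open>G\<close> is treated apart since then
  nothing forces \<open>0 \<le> H\<close>.\<close>

lemma integrable_weighted:
  assumes G: "G \<in> sets M" and GX: "\<forall>\<omega>\<in>G. x0 \<le> X n \<omega>"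
    and h [measurable]: "h \<in> borel_measurable M" and hH: "\<forall>\<omega>\<in>G. 0 \<le> h \<omega> \<and> h \<omega> \<le> H"
  shows "integrable M (\<lambda>\<omega>. indicat_real G \<omega> * h \<omega> * f (X n \<omega>))"
    and "integrable M (\<lambda>\<omega>. indicat_real G \<omega> * h \<omega> * f (X (Suc n) \<omega>))"
proof -
  note G [measurable]
  have *: "norm (indicat_real G \<omega> * h \<omega> * f x) \<le> H * f (x0 - B)"
    if "\<omega> \<in> G \<Longrightarrow> x0 - B \<le> x" "\<omega> \<in> G \<or> 0 \<le> H" for \<omega> x
    using that bspec[OF hH, of \<omega>] f_pos[of x] f_antimono[of "x0 - B" x] f_pos[of "x0 - B"]
    by (cases "\<omega> \<in> G") (auto simp: abs_mult intro!: mult_mono)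
  show "integrable M (\<lambda>\<omega>. indicat_real G \<omega> * h \<omega> * f (X n \<omega>))"
  proof (cases "G = {}")
    case False
    then have "0 \<le> H" using hH by force
    then show ?thesis
      by (intro integrable_const_bound[of _ "H * f (x0 - B)"] AE_I2 *) (use GX B_nonneg in force)+
  qed simp
  show "integrable M (\<lambda>\<omega>. indicat_real G \<omega> * h \<omega> * f (X (Suc n) \<omega>))"
  proof (cases "G = {}")
    case False
    then have H: "0 \<le> H" using hH by force
    show ?thesis
    proof (rule integrable_const_bound[of _ "H * f (x0 - B)"])
      show "AE \<omega> in M. norm (indicat_real G \<omega> * h \<omega> * f (X (Suc n) \<omega>)) \<le> H * f (x0 - B)"
        using bounded_increment[of n]
      proof eventually_elim
        case (elim \<omega>)
        then show ?case using GX H by (intro *) force+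
      qed
    qed measurable
  qed simp
qed

text \<open>The Taylor bound is integrated, powers of the increment are replaced by their
  conditional moments, and the drift condition makes the result nonpositive. The weight
  \<open>h\<close> makes it possible to divide by the value of \<open>f\<close> at a random
  level.\<close>

lemma supermartingale_step:
  assumes G: "G \<in> sets (F n)" and GX: "\<forall>\<omega>\<in>G. x0 \<le> X n \<omega>"
    and h: "h \<in> borel_measurable (F n)" and hH: "\<forall>\<omega>\<in>G. 0 \<le> h \<omega> \<and> h \<omega> \<le> H"
  shows "(\<integral>\<omega>. indicat_real G \<omega> * h \<omega> * f (X (Suc n) \<omega>) \<partial>M) \<le>
    (\<integral>\<omega>. indicat_real G \<omega> * h \<omega> * f (X n \<omega>) \<partial>M)"
proof (cases "G = {}")
  case False
  have H: "0 \<le> H" using hH False by force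
  have K: "0 \<le> K" using f1_bound[of x0] by linarith
  note GM = sets_F_M[OF G] and hM = measurable_from_subalg[OF subalg h]
  note int = integrable_weighted[OF GM GX hM hH]
  note [measurable] = h adapted G
  let ?a = "\<lambda>g \<omega>. indicat_real G \<omega> * h \<omega> * g (X n \<omega>)"
  have meas: "?a g \<in> borel_measurable (F n)" if [measurable]: "g \<in> borel_measurable borel" for g
    by measurable
  have bd: "AE \<omega> in M. \<bar>?a g \<omega>\<bar> \<le> H * K" if "\<And>x. x0 \<le> x \<Longrightarrow> \<bar>g x\<bar> \<le> K" for g
    using that hH GX H K by (intro AE_I2) (auto simp: indicator_def abs_mult intro!: mult_mono)
  note m1 = increment_moment_integral[OF meas[OF f1_measurable] bd[OF f1_bound], of 1]
  note m2 = increment_moment_integral[OF meas[OF f2_measurable] bd[OF f2_bound], of 2]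
  let ?\<Delta> = "\<lambda>\<omega>. X (Suc n) \<omega> - X n \<omega>"
  have "(\<integral>\<omega>. ?a f1 \<omega> * ?\<Delta> \<omega> ^ 1 + ?a f2 \<omega> * ?\<Delta> \<omega> ^ 2 \<partial>M) =
      (\<integral>\<omega>. ?a f1 \<omega> * increment_moment 1 n \<omega> + ?a f2 \<omega> * increment_moment 2 n \<omega> \<partial>M)"
    by (simp only: Bochner_Integration.integral_add[OF m1(1) m2(1)]
        Bochner_Integration.integral_add[OF m1(2) m2(2)] m1(3) m2(3))
  also have "\<dots> \<le> (\<integral>\<omega>. 0 \<partial>M)"
  proof (rule integral_mono_AE)
    show "AE \<omega> in M. ?a f1 \<omega> * increment_moment 1 n \<omega> + ?a f2 \<omega> * increment_moment 2 n \<omega> \<le> 0"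
      using drift[of n]
    proof eventually_elim
      case (elim \<omega>)
      have "?a f1 \<omega> * increment_moment 1 n \<omega> + ?a f2 \<omega> * increment_moment 2 n \<omega> =
        (indicat_real G \<omega> * h \<omega>) *
        (f1 (X n \<omega>) * increment_moment 1 n \<omega> + f2 (X n \<omega>) * increment_moment 2 n \<omega>)"
        by (simp add: algebra_simps)
      also have "\<dots> \<le> 0"
        using elim GX hH
        by (cases "\<omega> \<in> G") (auto intro!: mult_nonneg_nonpos)
      finally show ?case .
    qed
  qed (simp_all only: Bochner_Integration.integrable_add[OF m1(2) m2(2)] integrable_zero)
  finally have le0: "(\<integral>\<omega>. ?a f1 \<omega> * ?\<Delta> \<omega> ^ 1 + ?a f2 \<omega> * ?\<Delta> \<omega> ^ 2 \<partial>M) \<le> 0" by simp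
  have "(\<integral>\<omega>. indicat_real G \<omega> * h \<omega> * f (X (Suc n) \<omega>) \<partial>M) \<le>
    (\<integral>\<omega>. ?a f \<omega> + (?a f1 \<omega> * ?\<Delta> \<omega> ^ 1 + ?a f2 \<omega> * ?\<Delta> \<omega> ^ 2) \<partial>M)"
  proof (rule integral_mono_AE[OF int(2)])
    show "AE \<omega> in M. indicat_real G \<omega> * h \<omega> * f (X (Suc n) \<omega>) \<le>
        ?a f \<omega> + (?a f1 \<omega> * ?\<Delta> \<omega> ^ 1 + ?a f2 \<omega> * ?\<Delta> \<omega> ^ 2)"
      using bounded_increment[of n]
    proof eventually_elim
      case (elim \<omega>)
      show ?case
      proof (cases "\<omega> \<in> G")
        case True
        have "h \<omega> * f (X (Suc n) \<omega>) \<le>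
          h \<omega> * (f (X n \<omega>) + f1 (X n \<omega>) * ?\<Delta> \<omega> + f2 (X n \<omega>) * (?\<Delta> \<omega>)\<^sup>2)"
          using taylor[OF bspec[OF GX True] elim] bspec[OF hH True] by (intro mult_left_mono) auto
        then show ?thesis using True by (simp add: algebra_simps)
      qed simp
    qed
  qed (intro Bochner_Integration.integrable_add m1(1) m2(1) int(1))
  also have "\<dots> = (\<integral>\<omega>. ?a f \<omega> \<partial>M) + (\<integral>\<omega>. ?a f1 \<omega> * ?\<Delta> \<omega> ^ 1 + ?a f2 \<omega> * ?\<Delta> \<omega> ^ 2 \<partial>M)"
    by (intro Bochner_Integration.integral_add Bochner_Integration.integrable_add m1(1) m2(1) int(1))
  finally show ?thesis using le0 by simp
qed simp

text \<open>Optional stopping for \<open>f (X m) / f (Y)\<close> at the first return to a point not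
  above \<open>Y\<close>. It starts at most at \<open>1 - q\<close> and is at least 1 on return, so
  the return has probability at most \<open>1 - q\<close> relative to \<open>G\<close>. This is
  shown up to time \<open>n + k\<close>, and \<open>k\<close> then tends to infinity. The bound
  \<open>y1\<close> keeps the weight \<open>1 / f (Y \<omega>)\<close> bounded.\<close>

lemma prob_no_return:
  assumes G: "G \<in> sets (F n)" and Y: "Y \<in> borel_measurable (F n)"
    and GY: "\<And>\<omega>. \<omega> \<in> G \<Longrightarrow> x0 \<le> Y \<omega> \<and> Y \<omega> \<le> y1 \<and> Y \<omega> < X n \<omega>"
    and q: "\<And>\<omega>. \<omega> \<in> G \<Longrightarrow> f (X n \<omega>) \<le> (1 - q) * f (Y \<omega>)"
  shows "q * prob G \<le> prob {\<omega> \<in> G. \<forall>m\<ge>n. Y \<omega> < X m \<omega>}"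
proof (cases "G = {}")
  case False
  define A where "A k = {\<omega> \<in> G. \<forall>m\<in>{n..n + k}. Y \<omega> < X m \<omega>}" for k
  define h where "h \<omega> = 1 / f (Y \<omega>)" for \<omega>
  have GM: "G \<in> sets M" using sets_F_M[OF G] .
  have YM [measurable]: "Y \<in> borel_measurable M" using measurable_from_subalg[OF subalg Y] .
  have AF: "A k \<in> sets (F (n + k))" for k
  proof -
    have [measurable]: "Y \<in> borel_measurable (F (n + k))" "G \<in> sets (F (n + k))"
      using measurable_F_mono[OF _ Y] sets_F_mono[OF _ G] by auto
    have "{\<omega> \<in> space (F (n + k)). Y \<omega> < X m \<omega>} \<in> sets (F (n + k))" if "m \<le> n + k" for m
    proof -
      have [measurable]: "X m \<in> borel_measurable (F (n + k))" using adapted_le[OF that] .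
      show ?thesis by measurable
    qed
    then have "G \<inter> (\<Inter>m\<in>{n..n + k}. {\<omega> \<in> space (F (n + k)). Y \<omega> < X m \<omega>}) \<in> sets (F (n + k))"
      by (intro sets.Int sets.finite_INT) auto
    also have "G \<inter> (\<Inter>m\<in>{n..n + k}. {\<omega> \<in> space (F (n + k)). Y \<omega> < X m \<omega>}) = A k"
      using sets.sets_into_space[OF GM] by (auto simp: A_def space_F)
    finally show ?thesis .
  qed
  have AM [measurable]: "A k \<in> sets M" for k using sets_F_M[OF AF] .
  have AG: "A k \<subseteq> G" for k by (auto simp: A_def)
  have AX: "\<forall>\<omega>\<in>A k. x0 \<le> X (n + k) \<omega>" for k
  proof
    fix \<omega> assume "\<omega> \<in> A k"
    then have "\<omega> \<in> G" "Y \<omega> < X (n + k) \<omega>" by (simp_all add: A_def)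
    with GY[of \<omega>] show "x0 \<le> X (n + k) \<omega>" by linarith
  qed
  have hF: "h \<in> borel_measurable (F (n + k))" for k
  proof -
    have [measurable]: "Y \<in> borel_measurable (F (n + k))" using measurable_F_mono[OF _ Y] by auto
    show ?thesis unfolding h_def by measurable
  qed
  have hM: "h \<in> borel_measurable M" unfolding h_def by measurable
  have hH: "0 \<le> h \<omega> \<and> h \<omega> \<le> 1 / f y1" if "\<omega> \<in> G" for \<omega>
  proof -
    have "0 < f y1" "f y1 \<le> f (Y \<omega>)"
      using GY[OF that] B_nonneg by (intro f_pos f_antimono; linarith)+
    then show ?thesis by (simp add: h_def divide_simps)
  qed
  have hHA: "\<forall>\<omega>\<in>A k. 0 \<le> h \<omega> \<and> h \<omega> \<le> 1 / f y1" for k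
    using hH AG by blast
  note int = integrable_weighted[OF AM AX hM hHA]
  let ?D = "\<lambda>k. \<integral>\<omega>. indicat_real (A k) \<omega> * h \<omega> * f (X (n + k) \<omega>) \<partial>M"
  text \<open>On leaving \<open>A k\<close> the process is at a point not above \<open>Y\<close>, where \<open>f\<close> is at least \<open>f Y\<close>.\<close>
  have step: "?D (Suc k) + (prob (A k) - prob (A (Suc k))) \<le> ?D k" for k
  proof -
    have sub: "A (Suc k) \<subseteq> A k" by (auto simp: A_def)
    have split: "indicat_real (A k) \<omega> * h \<omega> * f (X (n + Suc k) \<omega>) \<ge>
       indicat_real (A (Suc k)) \<omega> * h \<omega> * f (X (n + Suc k) \<omega>) + indicat_real (A k - A (Suc k)) \<omega>"
      if "\<bar>X (Suc (n + k)) \<omega> - X (n + k) \<omega>\<bar> \<le> B" for \<omega>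
    proof (cases "\<omega> \<in> A k - A (Suc k)")
      case True
      have G: "\<omega> \<in> G" using True AG by blast
      have le: "X (n + Suc k) \<omega> \<le> Y \<omega>"
      proof (rule ccontr)
        assume "\<not> X (n + Suc k) \<omega> \<le> Y \<omega>"
        moreover have "\<forall>m\<in>{n..n + k}. Y \<omega> < X m \<omega>"
          using True by (simp add: A_def)
        ultimately have "\<forall>m\<in>{n..n + Suc k}. Y \<omega> < X m \<omega>"
          by (metis add_Suc_right atLeastAtMost_iff le_Suc_eq not_le)
        then show False using True by (simp add: A_def)
      qed
      \<comment> \<open>The last point before the return lies above \<open>x0\<close>, so the
        undershoot stays within the region where \<open>f\<close> is positive and
        decreasing.\<close>
      have ge: "x0 - B \<le> X (n + Suc k) \<omega>"
        using True bspec[OF AX, of \<omega> k] that by auto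
      have "f (Y \<omega>) \<le> f (X (n + Suc k) \<omega>)" "0 < f (Y \<omega>)"
        using ge le by (auto intro!: f_antimono f_pos)
      then have "1 \<le> h \<omega> * f (X (n + Suc k) \<omega>)"
        by (simp add: h_def divide_simps)
      then show ?thesis using True by auto
    next
      case False
      then show ?thesis using sub by (auto simp: indicator_def)
    qed
    have intS: "integrable M (\<lambda>\<omega>. indicat_real (A (Suc k)) \<omega> * h \<omega> * f (X (n + Suc k) \<omega>))"
      using int(1)[of "Suc k"] by simp
    have intI: "integrable M (indicat_real (A k - A (Suc k)))"
      by (intro integrable_real_indicator) (auto simp: emeasure_eq_measure)
    have "?D (Suc k) + (prob (A k) - prob (A (Suc k))) =
      (\<integral>\<omega>. indicat_real (A (Suc k)) \<omega> * h \<omega> * f (X (n + Suc k) \<omega>)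
        + indicat_real (A k - A (Suc k)) \<omega> \<partial>M)"
      using Bochner_Integration.integral_add[OF intS intI] finite_measure_Diff[OF AM AM sub]
      by simp
    also have "\<dots> \<le> (\<integral>\<omega>. indicat_real (A k) \<omega> * h \<omega> * f (X (n + Suc k) \<omega>) \<partial>M)"
    proof (rule integral_mono_AE)
      show "integrable M (\<lambda>\<omega>. indicat_real (A k) \<omega> * h \<omega> * f (X (n + Suc k) \<omega>))"
        using int(2)[of k] by simp
      show "AE \<omega> in M. indicat_real (A (Suc k)) \<omega> * h \<omega> * f (X (n + Suc k) \<omega>)
        + indicat_real (A k - A (Suc k)) \<omega> \<le> indicat_real (A k) \<omega> * h \<omega> * f (X (n + Suc k) \<omega>)"
        using bounded_increment[of "n + k"] by eventually_elim (rule split)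
      show "integrable M (\<lambda>\<omega>. indicat_real (A (Suc k)) \<omega> * h \<omega> * f (X (n + Suc k) \<omega>)
        + indicat_real (A k - A (Suc k)) \<omega>)"
        by (intro Bochner_Integration.integrable_add intS intI)
    qed
    also have "\<dots> \<le> ?D k"
      using supermartingale_step[OF AF AX hF hHA, of k] by simp
    finally show ?thesis .
  qed
  have D_nonneg: "0 \<le> ?D k" for k
  proof (intro integral_nonneg_AE AE_I2)
    fix \<omega>
    show "0 \<le> indicat_real (A k) \<omega> * h \<omega> * f (X (n + k) \<omega>)"
      using bspec[OF hHA, of \<omega> k] bspec[OF AX, of \<omega> k] f_pos[of "X (n + k) \<omega>"] B_nonneg
      by (cases "\<omega> \<in> A k") auto
  qed
  have tel: "?D k + (prob (A 0) - prob (A k)) \<le> ?D 0" for k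
  proof (induction k)
    case (Suc k)
    then show ?case using step[of k] by linarith
  qed simp
  have A0: "A 0 = G" using GY by (auto simp: A_def)
  have D0: "?D 0 \<le> (1 - q) * prob G"
  proof -
    have "?D 0 \<le> (\<integral>\<omega>. (1 - q) * indicat_real G \<omega> \<partial>M)"
    proof (rule integral_mono_AE)
      show "integrable M (\<lambda>\<omega>. indicat_real (A 0) \<omega> * h \<omega> * f (X (n + 0) \<omega>))"
        using int(1)[of 0] by simp
      show "integrable M (\<lambda>\<omega>. (1 - q) * indicat_real G \<omega>)"
        using GM by (intro integrable_mult_right integrable_real_indicator)
          (auto simp: emeasure_eq_measure)
      show "AE \<omega> in M. indicat_real (A 0) \<omega> * h \<omega> * f (X (n + 0) \<omega>) \<le> (1 - q) * indicat_real G \<omega>"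
      proof (rule AE_I2)
        fix \<omega>
        show "indicat_real (A 0) \<omega> * h \<omega> * f (X (n + 0) \<omega>) \<le> (1 - q) * indicat_real G \<omega>"
          using q[of \<omega>] GY[of \<omega>] f_pos[of "Y \<omega>"] B_nonneg
          by (cases "\<omega> \<in> G") (auto simp: A0 h_def divide_simps)
      qed
    qed
    then show ?thesis using GM by simp
  qed
  have ge: "q * prob G \<le> prob (A k)" for k
    using tel[of k] D0 D_nonneg[of k] unfolding A0 by (simp add: algebra_simps)
  have "(\<lambda>k. prob (A k)) \<longlonglongrightarrow> prob (\<Inter>k. A k)"
  proof (rule finite_Lim_measure_decseq)
    show "decseq A" by (auto simp: decseq_def A_def)
  qed (use AM in blast)
  then have "q * prob G \<le> prob (\<Inter>k. A k)"
    by (rule LIMSEQ_le_const) (use ge in auto)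
  also have "(\<Inter>k. A k) = {\<omega> \<in> G. \<forall>m\<ge>n. Y \<omega> < X m \<omega>}"
  proof -
    have "Y \<omega> < X m \<omega>" if "\<forall>k. \<omega> \<in> A k" "n \<le> m" for \<omega> m
      using that(1)[rule_format, of "m - n"] that(2) by (auto simp: A_def)
    then show ?thesis by (auto simp: A_def)
  qed
  finally show ?thesis .
qed simp

text \<open>Two stages: given \<open>G\<close>, a jump by more than \<open>\<epsilon>\<close> has
  probability at least \<open>\<delta> / (4 * B\<^sup>2)\<close>; after it, the no-return estimate
  is applied from time \<open>Suc n\<close> with \<open>Y = X n\<close> and contributes the factor
  \<open>q\<close>.\<close>

lemma prob_cutpoint_at:
  assumes G: "G \<in> sets (F n)" and GX: "\<And>\<omega>. \<omega> \<in> G \<Longrightarrow> t \<le> X n \<omega> \<and> X n \<omega> \<le> t + B"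
    and t: "x0 \<le> t"
    and moments: "AE \<omega> in M. \<omega> \<in> G \<longrightarrow>
      0 \<le> increment_moment 1 n \<omega> \<and> \<delta> \<le> increment_moment 2 n \<omega>"
    and \<epsilon>: "0 < \<epsilon>" "\<epsilon> * (\<epsilon> + B) \<le> \<delta> / 2"
    and q: "0 \<le> q" "\<And>y. t \<le> y \<Longrightarrow> y \<le> t + B \<Longrightarrow> f (y + \<epsilon>) \<le> (1 - q) * f y"
  shows "q * \<delta> / (4 * B\<^sup>2) * prob G \<le> prob {\<omega> \<in> G. \<forall>m>n. X n \<omega> < X m \<omega>}"
proof -
  define J where "J = {\<omega> \<in> G. X (Suc n) \<omega> > X n \<omega> + \<epsilon>}"
  have J: "J \<in> sets (F (Suc n))"
  proof -
    have [measurable]: "X n \<in> borel_measurable (F (Suc n))" "X (Suc n) \<in> borel_measurable (F (Suc n))"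
      "G \<in> sets (F (Suc n))"
      using adapted_le[of n "Suc n"] adapted sets_F_mono[OF _ G] by auto
    have "G \<inter> {\<omega> \<in> space (F (Suc n)). X (Suc n) \<omega> > X n \<omega> + \<epsilon>} \<in> sets (F (Suc n))"
      by measurable
    also have "G \<inter> {\<omega> \<in> space (F (Suc n)). X (Suc n) \<omega> > X n \<omega> + \<epsilon>} = J"
      using sets.sets_into_space[OF G] by (auto simp: J_def space_F)
    finally show ?thesis .
  qed
  have "\<delta> / (4 * B\<^sup>2) * prob G \<le> prob J"
    using prob_jump_up[OF G moments \<epsilon>] B_pos unfolding J_def by (simp add: field_simps)
  then have "q * (\<delta> / (4 * B\<^sup>2) * prob G) \<le> q * prob J"
    using q(1) by (rule mult_left_mono)
  also have "\<dots> \<le> prob {\<omega> \<in> J. \<forall>m\<ge>Suc n. X n \<omega> < X m \<omega>}"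
  proof (rule prob_no_return[OF J, where ?y1.0 = "t + B"])
    show "X n \<in> borel_measurable (F (Suc n))" by (rule adapted_le) simp
    show "x0 \<le> X n \<omega> \<and> X n \<omega> \<le> t + B \<and> X n \<omega> < X (Suc n) \<omega>" if "\<omega> \<in> J" for \<omega>
      using that GX[of \<omega>] \<epsilon> t by (auto simp: J_def)
    show "f (X (Suc n) \<omega>) \<le> (1 - q) * f (X n \<omega>)" if "\<omega> \<in> J" for \<omega>
    proof -
      have "f (X (Suc n) \<omega>) \<le> f (X n \<omega> + \<epsilon>)"
        using that GX[of \<omega>] \<epsilon> t B_pos by (intro f_antimono) (auto simp: J_def)
      also have "\<dots> \<le> (1 - q) * f (X n \<omega>)"
        using that GX[of \<omega>] by (intro q) (auto simp: J_def)
      finally show ?thesis .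
    qed
  qed
  also have "\<dots> \<le> prob {\<omega> \<in> G. \<forall>m>n. X n \<omega> < X m \<omega>}"
  proof (rule finite_measure_mono)
    have "G \<inter> {\<omega> \<in> space M. \<forall>m>n. X n \<omega> < X m \<omega>} \<in> sets M"
      using sets_F_M[OF G] by measurable
    also have "G \<inter> {\<omega> \<in> space M. \<forall>m>n. X n \<omega> < X m \<omega>} = {\<omega> \<in> G. \<forall>m>n. X n \<omega> < X m \<omega>}"
      using sets.sets_into_space[OF sets_F_M[OF G]] by auto
    finally show "{\<omega> \<in> G. \<forall>m>n. X n \<omega> < X m \<omega>} \<in> sets M" .
  qed (auto simp: J_def Suc_le_eq)
  finally show ?thesis by (simp add: mult.assoc)
qed

text \<open>Decomposes according to the first passage time over \<open>t\<close>: at that time the process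
  exceeds its whole past and lies in \<open>{t..t + B}\<close>.\<close>

lemma prob_cutpoint_event:
  assumes t: "x0 \<le> t"
    and moments: "\<And>n. AE \<omega> in M. x0 \<le> X n \<omega> \<longrightarrow>
      0 \<le> increment_moment 1 n \<omega> \<and> \<delta> \<le> increment_moment 2 n \<omega>"
    and unbounded: "AE \<omega> in M. \<exists>n. t \<le> X n \<omega>"
    and \<epsilon>: "0 < \<epsilon>" "\<epsilon> * (\<epsilon> + B) \<le> \<delta> / 2"
    and q: "0 \<le> q" "\<And>y. t \<le> y \<Longrightarrow> y \<le> t + B \<Longrightarrow> f (y + \<epsilon>) \<le> (1 - q) * f y"
  shows "q * \<delta> / (4 * B\<^sup>2) * prob {\<omega> \<in> space M. X 0 \<omega> < t} \<le> prob (cutpoint_event t)"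
proof -
  define A where "A n = {\<omega> \<in> space M. (\<forall>m<n. X m \<omega> < t) \<and> t \<le> X n \<omega> \<and> X n \<omega> \<le> t + B}" for n
  define C where "C n = {\<omega> \<in> A n. \<forall>m>n. X n \<omega> < X m \<omega>}" for n
  have AF: "A n \<in> sets (F n)" for n
  proof -
    have [measurable]: "X n \<in> borel_measurable (F n)" by (rule adapted)
    have "{\<omega> \<in> space (F n). X m \<omega> < t} \<in> sets (F n)" if "m < n" for m
    proof -
      have [measurable]: "X m \<in> borel_measurable (F n)" using adapted_le that by simp
      show ?thesis by measurable
    qed
    then have "{\<omega> \<in> space (F n). \<forall>m\<in>{..<n}. X m \<omega> < t} \<in> sets (F n)"
      by (intro sets.sets_Collect_finite_All) auto
    moreover have "{\<omega> \<in> space (F n). t \<le> X n \<omega> \<and> X n \<omega> \<le> t + B} \<in> sets (F n)"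
      by measurable
    ultimately have "{\<omega> \<in> space (F n). \<forall>m\<in>{..<n}. X m \<omega> < t} \<inter>
        {\<omega> \<in> space (F n). t \<le> X n \<omega> \<and> X n \<omega> \<le> t + B} \<in> sets (F n)"
      by (rule sets.Int)
    also have "{\<omega> \<in> space (F n). \<forall>m\<in>{..<n}. X m \<omega> < t} \<inter>
        {\<omega> \<in> space (F n). t \<le> X n \<omega> \<and> X n \<omega> \<le> t + B} = A n"
      by (auto simp: A_def space_F)
    finally show ?thesis .
  qed
  have AM [measurable]: "A n \<in> sets M" for n using sets_F_M[OF AF] .
  have CM: "C n \<in> sets M" for n
  proof -
    have "A n \<inter> {\<omega> \<in> space M. \<forall>m>n. X n \<omega> < X m \<omega>} \<in> sets M" by measurable
    also have "A n \<inter> {\<omega> \<in> space M. \<forall>m>n. X n \<omega> < X m \<omega>} = C n"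
      by (auto simp: C_def A_def)
    finally show ?thesis .
  qed
  have disjA: "disjoint_family A"
    by (auto simp: disjoint_family_on_def A_def) (metis linorder_neqE_nat not_le)
  then have disjC: "disjoint_family C"
    by (rule disjoint_family_subset) (auto simp: C_def)
  have le: "q * \<delta> / (4 * B\<^sup>2) * prob (A n) \<le> prob (C n)" for n
    unfolding C_def
  proof (rule prob_cutpoint_at[OF AF _ t _ \<epsilon> q])
    show "AE \<omega> in M. \<omega> \<in> A n \<longrightarrow> 0 \<le> increment_moment 1 n \<omega> \<and> \<delta> \<le> increment_moment 2 n \<omega>"
      using moments[of n] by eventually_elim (use t in \<open>auto simp: A_def\<close>)
  qed (auto simp: A_def)
  have "0 \<le> \<epsilon> * (\<epsilon> + B)" using \<epsilon>(1) B_pos by simp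
  then have \<delta>: "0 \<le> \<delta>" using \<epsilon>(2) by linarith
  have "prob {\<omega> \<in> space M. X 0 \<omega> < t} \<le> prob (\<Union>n. A n)"
  proof (rule finite_measure_mono_AE)
    have "AE \<omega> in M. \<forall>n. \<bar>X (Suc n) \<omega> - X n \<omega>\<bar> \<le> B"
      using bounded_increment by (simp add: AE_all_countable)
    then show "AE \<omega> in M. \<omega> \<in> {\<omega> \<in> space M. X 0 \<omega> < t} \<longrightarrow> \<omega> \<in> (\<Union>n. A n)"
      using unbounded
    proof eventually_elim
      case (elim \<omega>)
      show ?case
      proof
        assume \<omega>: "\<omega> \<in> {\<omega> \<in> space M. X 0 \<omega> < t}"
        define n where "n = (LEAST n. t \<le> X n \<omega>)"
        have n: "t \<le> X n \<omega>" using elim(2) unfolding n_def by (rule LeastI_ex)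
        have less: "X m \<omega> < t" if "m < n" for m
          using not_less_Least[of m] that unfolding n_def by force
        \<comment> \<open>The first passage time is not 0 because the path starts below
          \<open>t\<close>. Its predecessor is still below \<open>t\<close>, so one bounded
          increment gives the upper bound \<open>t + B\<close>.\<close>
        obtain k where k: "n = Suc k" using n \<omega> by (cases n) auto
        have "X n \<omega> \<le> t + B" using less[of k] elim(1)[rule_format, of k] k by auto
        then show "\<omega> \<in> (\<Union>n. A n)" using n less \<omega> by (auto simp: A_def)
      qed
    qed
  qed measurable
  then have "q * \<delta> / (4 * B\<^sup>2) * prob {\<omega> \<in> space M. X 0 \<omega> < t} \<le>
      q * \<delta> / (4 * B\<^sup>2) * prob (\<Union>n. A n)"
    using q(1) \<delta> by (intro mult_left_mono) auto
  also have "\<dots> \<le> prob (\<Union>n. C n)"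
  proof (rule sums_le[OF le])
    show "(\<lambda>n. q * \<delta> / (4 * B\<^sup>2) * prob (A n)) sums (q * \<delta> / (4 * B\<^sup>2) * prob (\<Union>n. A n))"
      using AM disjA by (intro sums_mult finite_measure_UNION) auto
    show "(\<lambda>n. prob (C n)) sums prob (\<Union>n. C n)"
      using CM disjC by (intro finite_measure_UNION) auto
  qed
  also have "\<dots> \<le> prob (cutpoint_event t)"
  proof (rule finite_measure_mono)
    show "(\<Union>n. C n) \<subseteq> cutpoint_event t"
      unfolding cutpoint_event_def C_def A_def by (auto, metis less_le_trans)
  qed measurable
  finally show ?thesis .
qed

end

text \<open>The coefficient \<open>log_potential'' \<gamma> (x - B) / 2\<close> is the uniform
  Taylor remainder. Both coefficients decrease in absolute value, so they are bounded through their
  sizes at \<open>x0\<close>; the sum of two positive numbers serves as a common bound.\<close>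

lemma log_potential_lyapunov:
  assumes "bounded_increments M F X B" and \<gamma>: "0 < \<gamma>" and x0: "1 < x0 - B"
    and drift: "\<And>n. AE \<omega> in M. x0 \<le> X n \<omega> \<longrightarrow>
      log_potential' \<gamma> (X n \<omega>) * bounded_increments.increment_moment M F X 1 n \<omega> +
      log_potential'' \<gamma> (X n \<omega> - B) / 2 * bounded_increments.increment_moment M F X 2 n \<omega> \<le> 0"
  shows "lyapunov M F X B (log_potential \<gamma>) (log_potential' \<gamma>)
    (\<lambda>x. log_potential'' \<gamma> (x - B) / 2) x0
    (- log_potential' \<gamma> x0 + log_potential'' \<gamma> (x0 - B))"
proof -
  interpret bounded_increments M F X B by fact
  have x0': "1 < x0" using x0 B_pos by simp
  have p: "log_potential' \<gamma> x0 < 0" "0 < log_potential'' \<gamma> (x0 - B)"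
    using log_potential'_neg[OF \<gamma> x0'] log_potential''_pos[OF \<gamma> x0] by auto
  show ?thesis
  proof
    show "\<bar>log_potential' \<gamma> x\<bar> \<le> - log_potential' \<gamma> x0 + log_potential'' \<gamma> (x0 - B)" if "x0 \<le> x" for x
      using log_potential'_mono[OF \<gamma> x0' that] log_potential'_neg[of \<gamma> x] \<gamma> x0' p that by simp
    show "\<bar>log_potential'' \<gamma> (x - B) / 2\<bar> \<le> - log_potential' \<gamma> x0 + log_potential'' \<gamma> (x0 - B)"
      if "x0 \<le> x" for x
      using log_potential''_antimono[OF \<gamma> x0, of "x - B"] log_potential''_pos[of \<gamma> "x - B"] \<gamma> x0 p that
      by simp
    show "log_potential \<gamma> (x + d) \<le>
        log_potential \<gamma> x + log_potential' \<gamma> x * d + log_potential'' \<gamma> (x - B) / 2 * d\<^sup>2"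
      if "x0 \<le> x" "\<bar>d\<bar> \<le> B" for x d
      using that x0 by (intro log_potential_taylor \<gamma>) auto
  qed (use \<gamma> x0 drift in \<open>auto intro!: log_potential_pos log_potential_antimono\<close>)
qed

theorem proposition1p4:
  fixes M :: "'a measure"
    and F :: "nat \<Rightarrow> 'a measure"
    and X :: "nat \<Rightarrow> 'a \<Rightarrow> real"
    and S :: "real set"
    and mu_lo mu_up :: "nat \<Rightarrow> real \<Rightarrow> real"
    and B \<theta> :: real
  assumes "prob_space M"
    and "filtration (space M) F"
    and "\<And>n. subalgebra M (F n)"
    and "S \<in> sets borel" and "S \<subseteq> {0..}"
    and "(INF x\<in>S. ereal x) = 0" and "(SUP x\<in>S. ereal x) = \<infinity>"
    and "\<And>n. X n \<in> borel_measurable (F n)"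
    and "\<And>n \<omega>. \<omega> \<in> space M \<Longrightarrow> X n \<omega> \<in> S"
    and "\<And>k. k \<in> {1, 2} \<Longrightarrow> mu_lo k \<in> borel_measurable (restrict_space borel S)"
    and "\<And>k. k \<in> {1, 2} \<Longrightarrow> mu_up k \<in> borel_measurable (restrict_space borel S)"
    and "\<And>k n. k \<in> {1, 2} \<Longrightarrow> AE \<omega> in M.
           mu_lo k (X n \<omega>) \<le> real_cond_exp M (F n) (\<lambda>\<omega>. (X (n + 1) \<omega> - X n \<omega>) ^ k) \<omega> \<and>
           real_cond_exp M (F n) (\<lambda>\<omega>. (X (n + 1) \<omega> - X n \<omega>) ^ k) \<omega> \<le> mu_up k (X n \<omega>)"
    and B: "\<And>n. AE \<omega> in M. \<bar>X (n + 1) \<omega> - X n \<omega>\<bar> \<le> B"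
    and N: "AE \<omega> in M. limsup (\<lambda>n. ereal (X n \<omega>)) = \<infinity>"
    and V: "Liminf (at_top_in S) (\<lambda>x. ereal (mu_lo 2 x)) > 0"
    and "\<theta> > 0"
    and "\<forall>\<^sub>F x in at_top_in S. 2 * x * mu_lo 1 x \<ge> (1 + (1 + \<theta>) / ln x) * mu_up 2 x"
    and "integrable M (X 0)"
  shows "(\<exists>c>0. \<forall>\<^sub>F x in at_top.
            (\<integral>\<^sup>+ \<omega>. num_elements (strong_cutpoints X \<omega> \<inter> {0..x}) \<partial>M) \<ge> ennreal (c * ln (ln x)))
       \<and> (\<integral>\<^sup>+ \<omega>. num_elements (strong_cutpoints X \<omega>) \<partial>M) = \<infinity>"
proof -

  \<comment> \<open>Choice of the constants and of a common threshold\<close>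
  interpret prob_space M by fact
  \<comment> \<open>Enlarging \<open>B\<close> supplies a strictly positive increment bound;
    \<open>\<gamma>\<close> is chosen positive, at most 1 and strictly below
    \<open>\<theta>\<close>; the spacing \<open>w\<close> exceeds \<open>b\<close>, which separates
    the intervals.\<close>
  define b where "b = max B 1"
  define \<gamma> where "\<gamma> = min (\<theta> / 2) 1"
  define w where "w = b + 1"
  have b: "0 < b" "B \<le> b" and w: "b < w" "0 < w" and \<gamma>: "0 < \<gamma>" "\<gamma> \<le> 1" "\<gamma> < \<theta>"
    using \<open>\<theta> > 0\<close> by (auto simp: b_def \<gamma>_def w_def)
  have bounded: "bounded_increments M F X b"
  proof (intro bounded_increments.intro bounded_increments_axioms.intro)
    show "AE \<omega> in M. \<bar>X (Suc n) \<omega> - X n \<omega>\<bar> \<le> b" for n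
      using B[of n] by eventually_elim (use b in simp)
  qed (use assms b in auto)
  interpret bounded_increments M F X b by fact

  obtain \<delta> :: real where \<delta>: "0 < \<delta>" and V': "\<forall>\<^sub>F x in at_top_in S. \<delta> < mu_lo 2 x"
  proof -
    obtain \<delta> where "(0::ereal) < \<delta>" "\<delta> < Liminf (at_top_in S) (\<lambda>x. ereal (mu_lo 2 x))"
      using dense[OF V] by auto
    then show ?thesis
      using that[of "real_of_ereal \<delta>"] less_LiminfD[of \<delta> "at_top_in S" "\<lambda>x. ereal (mu_lo 2 x)"]
      by (cases \<delta>) auto
  qed
  \<comment> \<open>The two arguments of the minimum give \<open>\<epsilon> + b \<le> 2 * b\<close>
    and \<open>\<epsilon> \<le> \<delta> / (4 * b)\<close>, whose product is
    \<open>\<delta> / 2\<close>.\<close>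
  define \<epsilon> where "\<epsilon> = min b (\<delta> / (4 * b))"
  have \<epsilon>: "0 < \<epsilon>" "\<epsilon> * (\<epsilon> + b) \<le> \<delta> / 2"
  proof -
    show "0 < \<epsilon>" using b \<delta> by (simp add: \<epsilon>_def)
    have "\<epsilon> * (\<epsilon> + b) \<le> \<delta> / (4 * b) * (b + b)"
      using b \<delta> by (intro mult_mono) (auto simp: \<epsilon>_def)
    also have "\<dots> = \<delta> / 2" using b by (simp add: field_simps)
    finally show "\<epsilon> * (\<epsilon> + b) \<le> \<delta> / 2" .
  qed

  obtain x1 where half: "\<And>s. x1 \<le> s \<Longrightarrow> 1 / 2 \<le> prob {\<omega> \<in> space M. X 0 \<omega> < s}"
    using prob_less_ge_half[OF X_measurable] by blast
  \<comment> \<open>Limits within \<open>S\<close> become implications, so that all conditions share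
    one threshold. The offset \<open>b + \<epsilon>\<close> covers every point reached from
    \<open>{x..x + b}\<close> by moving up by \<open>\<epsilon>\<close>.\<close>
  have "\<forall>\<^sub>F x in at_top. (x \<in> S \<longrightarrow> \<delta> < mu_lo 2 x) \<and>
      (x \<in> S \<longrightarrow> (1 + (1 + \<theta>) / ln x) * mu_up 2 x \<le> 2 * x * mu_lo 1 x) \<and>
      log_potential'' \<gamma> (x - b) \<le> (1 + (1 + \<theta>) / ln x) / x * - log_potential' \<gamma> x \<and>
      \<gamma> / (2 * w) * (ln (ln (x + w)) - ln (ln x)) \<le>
        - log_potential' \<gamma> (x + (b + \<epsilon>)) / log_potential \<gamma> x \<and>
      1 + b < x \<and> x1 \<le> x"
    using V' assms(17) b \<epsilon> w \<gamma> unfolding eventually_inf_principal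
    by (intro eventually_conj log_potential_drift_eventually log_log_increment_eventually
        eventually_gt_at_top eventually_ge_at_top) auto
  then obtain x0 where x0: "\<And>x. x0 \<le> x \<Longrightarrow> x \<in> S \<Longrightarrow> \<delta> < mu_lo 2 x"
      "\<And>x. x0 \<le> x \<Longrightarrow> x \<in> S \<Longrightarrow> (1 + (1 + \<theta>) / ln x) * mu_up 2 x \<le> 2 * x * mu_lo 1 x"
      "\<And>x. x0 \<le> x \<Longrightarrow>
        log_potential'' \<gamma> (x - b) \<le> (1 + (1 + \<theta>) / ln x) / x * - log_potential' \<gamma> x"
      "\<And>x. x0 \<le> x \<Longrightarrow> \<gamma> / (2 * w) * (ln (ln (x + w)) - ln (ln x)) \<le>
        - log_potential' \<gamma> (x + (b + \<epsilon>)) / log_potential \<gamma> x"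
      "\<And>x. x0 \<le> x \<Longrightarrow> 1 + b < x" "\<And>x. x0 \<le> x \<Longrightarrow> x1 \<le> x"
    unfolding eventually_at_top_linorder by blast

  \<comment> \<open>Conditional moments and drift above the threshold\<close>
  have moments: "AE \<omega> in M. x0 \<le> X n \<omega> \<longrightarrow>
      0 \<le> increment_moment 1 n \<omega> \<and> \<delta> \<le> increment_moment 2 n \<omega> \<and>
      log_potential' \<gamma> (X n \<omega>) * increment_moment 1 n \<omega> +
      log_potential'' \<gamma> (X n \<omega> - b) / 2 * increment_moment 2 n \<omega> \<le> 0" for n
  proof -
    have mu: "AE \<omega> in M. mu_lo k (X n \<omega>) \<le> increment_moment k n \<omega> \<and>
        increment_moment k n \<omega> \<le> mu_up k (X n \<omega>)" if "k \<in> {1, 2}" for k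
      using assms(12)[OF that, of n] by simp
    show ?thesis using mu[OF insertI1] mu[OF insertI2[OF singletonI]] AE_space
    proof eventually_elim
      case (elim \<omega>)
      show ?case
      proof
        assume x: "x0 \<le> X n \<omega>"
        have S: "X n \<omega> \<in> S" using assms(9) elim(3) .
        have \<delta>': "\<delta> \<le> increment_moment 2 n \<omega>" using x0(1)[OF x S] elim(2) by simp
        have "1 < X n \<omega> - b" using x0(5)[OF x] by simp
        note drift = log_potential_drift[OF \<gamma>(1) \<open>\<theta> > 0\<close> this less_imp_le[OF b(1)] x0(3)[OF x],
            of "mu_lo 1 (X n \<omega>)" "increment_moment 1 n \<omega>" "increment_moment 2 n \<omega>" "mu_up 2 (X n \<omega>)"]
        show "0 \<le> increment_moment 1 n \<omega> \<and> \<delta> \<le> increment_moment 2 n \<omega> \<and>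
          log_potential' \<gamma> (X n \<omega>) * increment_moment 1 n \<omega> +
          log_potential'' \<gamma> (X n \<omega> - b) / 2 * increment_moment 2 n \<omega> \<le> 0"
          using drift elim \<delta>' \<delta> x0(2)[OF x S] by simp
      qed
    qed
  qed
  interpret lyapunov M F X b "log_potential \<gamma>" "log_potential' \<gamma>"
    "\<lambda>x. log_potential'' \<gamma> (x - b) / 2" x0 "- log_potential' \<gamma> x0 + log_potential'' \<gamma> (x0 - b)"
  proof (rule log_potential_lyapunov[OF bounded \<gamma>(1)])
    show "1 < x0 - b" using x0(5)[of x0] by simp
    show "AE \<omega> in M. x0 \<le> X n \<omega> \<longrightarrow>
      log_potential' \<gamma> (X n \<omega>) * increment_moment 1 n \<omega> +
      log_potential'' \<gamma> (X n \<omega> - b) / 2 * increment_moment 2 n \<omega> \<le> 0" for n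
      using moments[of n] by eventually_elim simp
  qed

  \<comment> \<open>The factor \<open>\<epsilon> * (\<gamma> / (2 * w))\<close> comes from the
    escape probability, \<open>\<delta> / (4 * b\<^sup>2)\<close> from the upward jump, and the
    final 1/2 from starting below the level.\<close>
  define c where "c = \<epsilon> * (\<gamma> / (2 * w)) * \<delta> / (4 * b\<^sup>2) / 2"
  have c: "0 < c" using \<epsilon> \<gamma> w \<delta> b by (simp add: c_def)
  have ll_mono: "ln (ln s) \<le> ln (ln r)" if "x0 \<le> s" "s \<le> r" for s r
    using x0(5)[of s] that b by simp

  \<comment> \<open>Probability of a cutpoint just above a given level\<close>
  have prob_ge: "c * (ln (ln (s + w)) - ln (ln s)) \<le> prob (cutpoint_event s)" if s: "x0 \<le> s" for s
  proof -
    have s1: "1 < s" using x0(5)[OF s] b by simp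
    \<comment> \<open>This \<open>q\<close> is small enough to be a relative decrease of the
      potential over a step \<open>\<epsilon>\<close> from any \<open>y\<close> in
      \<open>{s..s + b}\<close>, and it is already an increment of \<open>ln (ln s)\<close>, ready
      for telescoping.\<close>
    define q where "q = \<epsilon> * (\<gamma> / (2 * w) * (ln (ln (s + w)) - ln (ln s)))"
    have ll: "0 \<le> ln (ln (s + w)) - ln (ln s)" using ll_mono[of s "s + w"] s w by simp
    have q0: "0 \<le> q" unfolding q_def using \<epsilon> \<gamma> w ll by (intro mult_nonneg_nonneg) auto
    have q: "log_potential \<gamma> (y + \<epsilon>) \<le> (1 - q) * log_potential \<gamma> y" if y: "s \<le> y" "y \<le> s + b" for y
    proof -
      have pos: "0 < log_potential \<gamma> s" using s1 by (rule log_potential_pos)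
      have "q \<le> \<epsilon> * (- log_potential' \<gamma> (s + (b + \<epsilon>)) / log_potential \<gamma> s)"
        unfolding q_def using x0(4)[OF s] \<epsilon> by (intro mult_left_mono) auto
      then have "q * log_potential \<gamma> s \<le> \<epsilon> * - log_potential' \<gamma> (s + (b + \<epsilon>))"
        using pos by (simp add: field_simps)
      moreover have "q * log_potential \<gamma> y \<le> q * log_potential \<gamma> s"
        using log_potential_antimono[OF \<gamma>(1) s1 y(1)] q0 by (rule mult_left_mono)
      moreover have "\<epsilon> * - log_potential' \<gamma> (s + (b + \<epsilon>)) \<le> log_potential \<gamma> y - log_potential \<gamma> (y + \<epsilon>)"
        using s1 y by (intro log_potential_decrease \<gamma> \<epsilon>) auto
      ultimately show ?thesis by (simp add: algebra_simps)
    qed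
    have "q * \<delta> / (4 * b\<^sup>2) * prob {\<omega> \<in> space M. X 0 \<omega> < s} \<le> prob (cutpoint_event s)"
    proof (rule prob_cutpoint_event[OF s _ _ \<epsilon> q0 q])
      show "AE \<omega> in M. x0 \<le> X n \<omega> \<longrightarrow>
          0 \<le> increment_moment 1 n \<omega> \<and> \<delta> \<le> increment_moment 2 n \<omega>" for n
        using moments[of n] by eventually_elim simp
      show "AE \<omega> in M. \<exists>n. s \<le> X n \<omega>"
        using N by eventually_elim (rule limsup_infinity_imp_exceeds)
    qed
    moreover have "q * \<delta> / (4 * b\<^sup>2) * (1 / 2) \<le>
        q * \<delta> / (4 * b\<^sup>2) * prob {\<omega> \<in> space M. X 0 \<omega> < s}"
      using half[OF x0(6)[OF s]] q0 \<delta> by (intro mult_left_mono) auto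
    moreover have "c * (ln (ln (s + w)) - ln (ln s)) = q * \<delta> / (4 * b\<^sup>2) * (1 / 2)"
      by (simp add: c_def q_def)
    ultimately show ?thesis by linarith
  qed

  \<comment> \<open>Growth and divergence of the expected number of cutpoints\<close>
  have "\<forall>\<^sub>F x in at_top. c / 2 * ln (ln x) \<le> c * (ln (ln (x - w)) - ln (ln x0)) \<and> x0 + w \<le> x"
    using log_log_tail_eventually[OF c] eventually_ge_at_top by (rule eventually_conj)
  then have ev: "\<forall>\<^sub>F x in at_top. ennreal (c / 2 * ln (ln x)) \<le>
      (\<integral>\<^sup>+ \<omega>. num_elements (strong_cutpoints X \<omega> \<inter> {0..x}) \<partial>M)"
  proof eventually_elim
    case (elim x)
    have "ennreal (c / 2 * ln (ln x)) \<le> ennreal (c * (ln (ln (x - w)) - ln (ln x0)))"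
      using elim by (intro ennreal_leI) simp
    also have "\<dots> \<le> (\<integral>\<^sup>+ \<omega>. num_elements (strong_cutpoints X \<omega> \<inter> {0..x}) \<partial>M)"
      using elim c x0(5)[of x0] b ll_mono prob_ge w
      by (intro expected_strong_cutpoints_ge[where g = "\<lambda>x. ln (ln x)"]) auto
    finally show ?case .
  qed
  have "(\<integral>\<^sup>+ \<omega>. num_elements (strong_cutpoints X \<omega>) \<partial>M) = \<infinity>"
  proof (rule ccontr)
    assume "(\<integral>\<^sup>+ \<omega>. num_elements (strong_cutpoints X \<omega>) \<partial>M) \<noteq> \<infinity>"
    then obtain r where r: "0 \<le> r" "(\<integral>\<^sup>+ \<omega>. num_elements (strong_cutpoints X \<omega>) \<partial>M) = ennreal r"
      by (metis ennreal_cases infinity_ennreal_def)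
    \<comment> \<open>A finite expectation \<open>r\<close> would dominate the expected counts on
      all \<open>{0..x}\<close>, whose lower bound tends to infinity.\<close>
    have "\<forall>\<^sub>F x in at_top. r < c / 2 * ln (ln x)"
      using c by (intro log_log_exceeds_eventually) simp
    with ev have "\<forall>\<^sub>F x :: real in at_top. False"
    proof eventually_elim
      case (elim x)
      have "(\<integral>\<^sup>+ \<omega>. num_elements (strong_cutpoints X \<omega> \<inter> {0..x}) \<partial>M) \<le>
          (\<integral>\<^sup>+ \<omega>. num_elements (strong_cutpoints X \<omega>) \<partial>M)"
        unfolding num_elements_def by (intro nn_integral_mono emeasure_mono) auto
      with elim(1) have "ennreal (c / 2 * ln (ln x)) \<le> ennreal r" unfolding r(2) by (rule order_trans)
      then show False using elim(2) r(1) by (simp add: ennreal_le_iff)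
    qed
    then show False by (simp add: trivial_limit_at_top_linorder)
  qed
  with ev c show ?thesis by (intro conjI exI[of _ "c / 2"]) auto
qed

end
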